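(* Let $m,n$ be positive integers and let $\mathcal I=\{1,\dots,m+n\}$. In the quantum superalgebra $U_q[gl(m|n)]$, with generators $K_a^N$ and ${E^b}_c$ (simple and nonsimple), $$K_a^N\,{E^b}_c \;=\; q_a^{\,N(\delta^a_b-\delta^a_c)}\;{E^b}_c\,K_a^N$$ for all indices $a,b,c\in\mathcal I$ (that is, for $b<c$, $b>c$, and also $b=c$) and any power $N$.
   Context: Grading on indices: $[a]=0$ if $a\le m$ and $[a]=1$ if $a>m$, for $a\in\mathcal I$. The parameter $q$ is a nonzero complex variable (generic, in particular $q^2\neq 1$), with roots/powers $q^N$ fixed consistently. Write $q_a:=q^{(-1)^{[a]}}$, $\overline q_a:=q_a^{-1}$, $\overline q:=q^{-1}$, $\overline K_a:=K_a^{-1}$. $\delta^a_b$ is the Kronecker delta. $U_q[gl(m|n)]$ is the unital associative $\mathbb Z_2$-graded algebra over $\mathbb C$ generated by the Cartan elements $K_a^N$ ($a\in\mathcal I$) and the simple lowering and raising generators ${E^{a+1}}_a$, ${E^a}_{a+1}$ ($1\le a<m+n$). Powers $N$ of $K_a$ are allowed to be non-integral (typically $N\in\frac12\mathbb Z$), with $K_a^0=\mathrm{Id}$ and $K_a^MK_a^N=K_a^{M+N}$; formally $K_a=q_a^{{E^a}_a}$, so $K_a^N=q_a^{N{E^a}_a}$. The grading is $[K_a^N]=0$, $[{E^a}_b]=[a]+[b]\pmod 2$, and $[X,Y]=XY-(-1)^{[X][Y]}YX$ is the graded commutator of homogeneous elements. The relations are: (1) $K_a^MK_b^N=K_b^NK_a^M$.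 (2) $K_a\,{E^b}_{b\pm1}\,\overline K_a=q_a^{\delta^a_b-\delta^a_{b\pm1}}{E^b}_{b\pm1}$. In accordance with $K_a^N=q_a^{N{E^a}_a}$, this is understood to hold also with $q$ replaced by $q^N$, i.e. $K_a^N\,{E^b}_{b\pm1}=q_a^{N(\delta^a_b-\delta^a_{b\pm1})}{E^b}_{b\pm1}K_a^N$ for simple generators. (3) $[{E^a}_{a+1},{E^{b+1}}_b]=\delta^a_b\,\dfrac{K_a\overline K_{a+1}-\overline K_aK_{a+1}}{q_a-\overline q_a}$; and for $|a-b|>1$, ${E^{a+1}}_a{E^{b+1}}_b={E^{b+1}}_b{E^{a+1}}_a$ and ${E^a}_{a+1}{E^b}_{b+1}={E^b}_{b+1}{E^a}_{a+1}$. (4) $({E^m}_{m+1})^2=({E^{m+1}}_m)^2=0$. (5) Serre relations (whenever the indices make sense): for $a\ne m$, and with $(X,Y)$ equal to $({E^{a+1}}_a,{E^{a\pm1+1}}_{a\pm1})$ or $({E^a}_{a+1},{E^{a\pm1}}_{a\pm1+1})$, $X^2Y-(q+\overline q)XYX+YX^2=0$; and $[{E^{m+1}}_m,{E^{m+2}}_{m-1}]=[{E^m}_{m+1},{E^{m-1}}_{m+2}]=0$ (anticommutators, with the nonsimple generators defined below). The nonsimple generators are defined recursively, for $a<b$ with $b-a>1$ and any index $c$ with $a<c<b$ (no sum; the result does not depend on $c$), by $${E^b}_a={E^b}_c{E^c}_a-q_c\,{E^c}_a{E^b}_c\ \text{(lowering)},\qquad {E^a}_b={E^a}_c{E^c}_b-\overline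 q_c\,{E^c}_b{E^a}_c\ \text{(raising)}.$$ Convention for $b=c$: ${E^b}_b$ is identified through $K_b=q^{(-1)^{[b]}{E^b}_b}$, so the claim for $b=c$, namely $K_a^N{E^b}_b={E^b}_bK_a^N$, is understood as equivalent to the commutation of $K_a^N$ with the powers of $K_b$. *)

theory Defs
  imports Complex_Main "HOL-Algebra.QuotRing" "HOL-Library.Poly_Mapping"
begin

section \<open>Free associative algebras\<close>

text \<open>The free monoid, written additively so that the convolution product of
  \<open>'g word_monoid \<Rightarrow>\<^sub>0 complex\<close> is the product of the free associative
  \<open>\<complex>\<close>-algebra on \<^typ>\<open>'g\<close>.\<close>

datatype 'g word_monoid = Word (letters: "'g list")

instantiation word_monoid :: (type) monoid_add
begin
definition zero_word_monoid :: "'a word_monoid" where "0 = Word []"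
definition plus_word_monoid :: "'a word_monoid \<Rightarrow> 'a word_monoid \<Rightarrow> 'a word_monoid"
  where "u + v = Word (letters u @ letters v)"
instance by standard (auto simp: zero_word_monoid_def plus_word_monoid_def)
end

type_synonym 'g free_algebra = "'g word_monoid \<Rightarrow>\<^sub>0 complex"

definition gen :: "'g \<Rightarrow> 'g free_algebra"
  where "gen g = Poly_Mapping.single (Word [g]) 1"

definition scalar :: "complex \<Rightarrow> 'g free_algebra"
  where "scalar c = Poly_Mapping.single 0 c"

definition free_alg_ring :: "'g set \<Rightarrow> 'g free_algebra ring"
  where "free_alg_ring G =
    \<lparr>carrier = {x. \<forall>w\<in>Poly_Mapping.keys x. set (letters w) \<subseteq> G},
     mult = (*), one = 1, zero = 0, add = (+)\<rparr>"


section \<open>Generators and grading\<close>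

text \<open>\<open>Cartan a N\<close> stands for \<open>K\<^sub>a\<^sup>N\<close>, \<open>Lower a\<close> for \<open>E\<^sup>a\<^sup>+\<^sup>1\<^sub>a\<close>, and \<open>Raise a\<close>
  for \<open>E\<^sup>a\<^sub>a\<^sub>+\<^sub>1\<close>.

  The powers are packaged as a set \<open>P\<close> of admissible exponents (such as the
  half-integers) and a function \<open>qp\<close>, where \<open>qp x\<close> is the chosen value of \<open>q\<^sup>x\<close>
  for \<open>x \<in> P\<close>.\<close>

datatype generator = Cartan nat complex | Lower nat | Raise nat

definition generators :: "nat \<Rightarrow> nat \<Rightarrow> complex set \<Rightarrow> generator set"
  where "generators m n P =
    {Cartan a N |a N. a \<in> {1..m+n} \<and> N \<in> P}
    \<union> Lower ` {1..<m+n} \<union> Raise ` {1..<m+n}"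

definition idx_grade :: "nat \<Rightarrow> nat \<Rightarrow> nat"
  where "idx_grade m a = (if a \<le> m then 0 else 1)"

fun gen_grade :: "nat \<Rightarrow> generator \<Rightarrow> nat"
  where
    "gen_grade m (Cartan a N) = 0"
  | "gen_grade m (Lower a) = (idx_grade m (a+1) + idx_grade m a) mod 2"
  | "gen_grade m (Raise a) = (idx_grade m a + idx_grade m (a+1)) mod 2"

definition homogeneous :: "nat \<Rightarrow> nat \<Rightarrow> generator free_algebra \<Rightarrow> bool"
  where "homogeneous m p x \<longleftrightarrow>
    (\<forall>w\<in>Poly_Mapping.keys x. (\<Sum>g\<leftarrow>letters w. gen_grade m g) mod 2 = p mod 2)"

text \<open>Only meaningful for homogeneous \<open>x\<close>; zero is homogeneous of both degrees, and
  which one is picked is immaterial for the graded commutator.\<close>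

definition grade :: "nat \<Rightarrow> generator free_algebra \<Rightarrow> nat"
  where "grade m x = (if homogeneous m 1 x then 1 else 0)"

definition graded_comm ::
    "nat \<Rightarrow> generator free_algebra \<Rightarrow> generator free_algebra \<Rightarrow> generator free_algebra"
  where "graded_comm m x y = x * y - (- 1) ^ (grade m x * grade m y) * (y * x)"

text \<open>\<open>qpow m qp a x\<close> is \<open>q\<^sub>a\<^sup>x\<close>, where \<open>q\<^sub>a = q\<close> for even \<open>a\<close> and \<open>q\<^sub>a = q\<^sup>-\<^sup>1\<close> for
  odd \<open>a\<close>.\<close>

definition qpow :: "nat \<Rightarrow> (complex \<Rightarrow> complex) \<Rightarrow> nat \<Rightarrow> complex \<Rightarrow> complex"
  where "qpow m qp a x = qp ((- 1) ^ idx_grade m a * x)"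

definition kdelta :: "nat \<Rightarrow> nat \<Rightarrow> complex"
  where "kdelta a b = (if a = b then 1 else 0)"


section \<open>Simple and nonsimple root vectors in the free algebra\<close>

text \<open>\<open>freeE m qp b a\<close> represents \<open>E\<^sup>b\<^sub>a\<close>. The recursion splits at the index
  following the smaller one; lemmas \<open>Uq_E_lowering\<close> and \<open>Uq_E_raising\<close> below show
  that in the quantum superalgebra every intermediate index gives the same element.
  The diagonal \<open>E\<^sup>a\<^sub>a\<close> is not an element of the algebra (only the \<open>K\<^sub>a\<^sup>N\<close> are), and
  the value there is a dummy.\<close>

function freeE :: "nat \<Rightarrow> (complex \<Rightarrow> complex) \<Rightarrow> nat \<Rightarrow> nat \<Rightarrow> generator free_algebra"
  where "freeE m qp b a =
    (if b = a + 1 then gen (Lower a)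
     else if a = b + 1 then gen (Raise b)
     else if a < b then
       freeE m qp b (a+1) * freeE m qp (a+1) a
       - scalar (qpow m qp (a+1) 1) * (freeE m qp (a+1) a * freeE m qp b (a+1))
     else if b < a then
       freeE m qp b (b+1) * freeE m qp (b+1) a
       - scalar (qpow m qp (b+1) (- 1)) * (freeE m qp (b+1) a * freeE m qp b (b+1))
     else 0)"
  by pat_completeness auto
termination
  by (relation "measure (\<lambda>(m, qp, b, a). (b - a) + (a - b))") auto

declare freeE.simps [simp del]

abbreviation freeK :: "nat \<Rightarrow> complex \<Rightarrow> generator free_algebra"
  where "freeK a N \<equiv> gen (Cartan a N)"


section \<open>The quantum superalgebra\<close>

text \<open>Each relation \<open>l = r\<close> is recorded as the element \<open>l - r\<close>.\<close>

definition cartan_relations ::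
    "nat \<Rightarrow> nat \<Rightarrow> complex set \<Rightarrow> (complex \<Rightarrow> complex) \<Rightarrow> generator free_algebra set"
  where "cartan_relations m n P qp =
    {freeK a 0 - 1 |a. a \<in> {1..m+n}}
    \<union> {freeK a M * freeK a N - freeK a (M + N) |a M N. a \<in> {1..m+n} \<and> M \<in> P \<and> N \<in> P}
    \<union> {freeK a M * freeK b N - freeK b N * freeK a M |a b M N.
         a \<in> {1..m+n} \<and> b \<in> {1..m+n} \<and> M \<in> P \<and> N \<in> P}"

definition weight_relations ::
    "nat \<Rightarrow> nat \<Rightarrow> complex set \<Rightarrow> (complex \<Rightarrow> complex) \<Rightarrow> generator free_algebra set"
  where "weight_relations m n P qp =
    {freeK a N * freeE m qp b c
       - scalar (qpow m qp a (N * (kdelta a b - kdelta a c))) * (freeE m qp b c * freeK a N)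
       |a b c N. a \<in> {1..m+n} \<and> b \<in> {1..m+n} \<and> c \<in> {1..m+n} \<and> N \<in> P
         \<and> (c = b + 1 \<or> b = c + 1)}"

definition raise_lower_relations ::
    "nat \<Rightarrow> nat \<Rightarrow> complex set \<Rightarrow> (complex \<Rightarrow> complex) \<Rightarrow> generator free_algebra set"
  where "raise_lower_relations m n P qp =
    {graded_comm m (freeE m qp a (a+1)) (freeE m qp (b+1) b)
       - scalar (kdelta a b / (qpow m qp a 1 - inverse (qpow m qp a 1)))
         * (freeK a 1 * freeK (a+1) (- 1) - freeK a (- 1) * freeK (a+1) 1)
       |a b. a \<in> {1..<m+n} \<and> b \<in> {1..<m+n}}"

definition distant_relations ::
    "nat \<Rightarrow> nat \<Rightarrow> complex set \<Rightarrow> (complex \<Rightarrow> complex) \<Rightarrow> generator free_algebra set"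
  where "distant_relations m n P qp =
    {freeE m qp (a+1) a * freeE m qp (b+1) b - freeE m qp (b+1) b * freeE m qp (a+1) a
       |a b. a \<in> {1..<m+n} \<and> b \<in> {1..<m+n} \<and> (a + 1 < b \<or> b + 1 < a)}
    \<union> {freeE m qp a (a+1) * freeE m qp b (b+1) - freeE m qp b (b+1) * freeE m qp a (a+1)
       |a b. a \<in> {1..<m+n} \<and> b \<in> {1..<m+n} \<and> (a + 1 < b \<or> b + 1 < a)}"

definition nilpotency_relations ::
    "nat \<Rightarrow> nat \<Rightarrow> complex set \<Rightarrow> (complex \<Rightarrow> complex) \<Rightarrow> generator free_algebra set"
  where "nilpotency_relations m n P qp =
    {freeE m qp m (m+1) ^ 2, freeE m qp (m+1) m ^ 2}"

definition serre :: "complex \<Rightarrow> generator free_algebra \<Rightarrow> generator free_algebra \<Rightarrow> generator free_algebra"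
  where "serre q x y = x * x * y - scalar (q + inverse q) * (x * y * x) + y * x * x"

text \<open>In the last two relations all elements are odd, so that the graded commutators
  are anticommutators.\<close>

definition serre_relations ::
    "nat \<Rightarrow> nat \<Rightarrow> complex set \<Rightarrow> (complex \<Rightarrow> complex) \<Rightarrow> generator free_algebra set"
  where "serre_relations m n P qp =
    {serre (qp 1) (freeE m qp (a+1) a) (freeE m qp (b+1) b)
       |a b. a \<in> {1..<m+n} \<and> b \<in> {1..<m+n} \<and> a \<noteq> m \<and> (b = a + 1 \<or> a = b + 1)}
    \<union> {serre (qp 1) (freeE m qp a (a+1)) (freeE m qp b (b+1))
       |a b. a \<in> {1..<m+n} \<and> b \<in> {1..<m+n} \<and> a \<noteq> m \<and> (b = a + 1 \<or> a = b + 1)}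
    \<union> {r. 2 \<le> m \<and> 2 \<le> n \<and>
         (r = graded_comm m (freeE m qp (m+1) m) (freeE m qp (m+2) (m-1))
          \<or> r = graded_comm m (freeE m qp m (m+1)) (freeE m qp (m-1) (m+2)))}"

definition Uq_relations ::
    "nat \<Rightarrow> nat \<Rightarrow> complex set \<Rightarrow> (complex \<Rightarrow> complex) \<Rightarrow> generator free_algebra set"
  where "Uq_relations m n P qp =
    cartan_relations m n P qp \<union> weight_relations m n P qp \<union> raise_lower_relations m n P qp
    \<union> distant_relations m n P qp \<union> nilpotency_relations m n P qp \<union> serre_relations m n P qp"

definition Uq_free :: "nat \<Rightarrow> nat \<Rightarrow> complex set \<Rightarrow> generator free_algebra ring"
  where "Uq_free m n P = free_alg_ring (generators m n P)"

definition Uq_ideal ::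
    "nat \<Rightarrow> nat \<Rightarrow> complex set \<Rightarrow> (complex \<Rightarrow> complex) \<Rightarrow> generator free_algebra set"
  where "Uq_ideal m n P qp = genideal (Uq_free m n P) (Uq_relations m n P qp)"

definition Uq ::
    "nat \<Rightarrow> nat \<Rightarrow> complex set \<Rightarrow> (complex \<Rightarrow> complex) \<Rightarrow> generator free_algebra set ring"
  where "Uq m n P qp = Uq_free m n P Quot Uq_ideal m n P qp"

definition Uq_class ::
    "nat \<Rightarrow> nat \<Rightarrow> complex set \<Rightarrow> (complex \<Rightarrow> complex)
      \<Rightarrow> generator free_algebra \<Rightarrow> generator free_algebra set"
  where "Uq_class m n P qp x = Uq_ideal m n P qp +>\<^bsub>Uq_free m n P\<^esub> x"

definition Uq_K ::
    "nat \<Rightarrow> nat \<Rightarrow> complex set \<Rightarrow> (complex \<Rightarrow> complex)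
      \<Rightarrow> nat \<Rightarrow> complex \<Rightarrow> generator free_algebra set"
  where "Uq_K m n P qp a N = Uq_class m n P qp (freeK a N)"

definition Uq_E ::
    "nat \<Rightarrow> nat \<Rightarrow> complex set \<Rightarrow> (complex \<Rightarrow> complex)
      \<Rightarrow> nat \<Rightarrow> nat \<Rightarrow> generator free_algebra set"
  where "Uq_E m n P qp b c = Uq_class m n P qp (freeE m qp b c)"

text \<open>The \<open>\<complex>\<close>-algebra structure is given by the central elements \<open>c \<cdot> 1\<close>.\<close>

definition Uq_scalar ::
    "nat \<Rightarrow> nat \<Rightarrow> complex set \<Rightarrow> (complex \<Rightarrow> complex) \<Rightarrow> complex \<Rightarrow> generator free_algebra set"
  where "Uq_scalar m n P qp c = Uq_class m n P qp (scalar c)"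


section \<open>Well-definedness\<close>

lemma free_alg_ring_simps [simp]:
  "x \<otimes>\<^bsub>free_alg_ring G\<^esub> y = x * y" "\<one>\<^bsub>free_alg_ring G\<^esub> = 1"
  "x \<oplus>\<^bsub>free_alg_ring G\<^esub> y = x + y" "\<zero>\<^bsub>free_alg_ring G\<^esub> = 0"
  by (simp_all add: free_alg_ring_def)

lemma mem_free_alg_ring:
  "x \<in> carrier (free_alg_ring G) \<longleftrightarrow> (\<forall>w\<in>Poly_Mapping.keys x. set (letters w) \<subseteq> G)"
  by (simp add: free_alg_ring_def)

lemma free_alg_closed:
  shows "x \<in> carrier (free_alg_ring G) \<Longrightarrow> y \<in> carrier (free_alg_ring G)
      \<Longrightarrow> x + y \<in> carrier (free_alg_ring G)"
    and "x \<in> carrier (free_alg_ring G) \<Longrightarrow> y \<in> carrier (free_alg_ring G)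
      \<Longrightarrow> x - y \<in> carrier (free_alg_ring G)"
    and "x \<in> carrier (free_alg_ring G) \<Longrightarrow> y \<in> carrier (free_alg_ring G)
      \<Longrightarrow> x * y \<in> carrier (free_alg_ring G)"
    and "x \<in> carrier (free_alg_ring G) \<Longrightarrow> - x \<in> carrier (free_alg_ring G)"
    and "1 \<in> carrier (free_alg_ring G)"
    and "0 \<in> carrier (free_alg_ring G)"
    and "scalar c \<in> carrier (free_alg_ring G)"
    and "g \<in> G \<Longrightarrow> gen g \<in> carrier (free_alg_ring G)"
proof -
  show "x + y \<in> carrier (free_alg_ring G)"
    if "x \<in> carrier (free_alg_ring G)" "y \<in> carrier (free_alg_ring G)"
    using that Poly_Mapping.keys_add[of x y] unfolding mem_free_alg_ring by blast
  show "x - y \<in> carrier (free_alg_ring G)"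
    if "x \<in> carrier (free_alg_ring G)" "y \<in> carrier (free_alg_ring G)"
    using that keys_diff[of x y] unfolding mem_free_alg_ring by blast
  show "x * y \<in> carrier (free_alg_ring G)"
    if "x \<in> carrier (free_alg_ring G)" "y \<in> carrier (free_alg_ring G)"
    unfolding mem_free_alg_ring
  proof
    fix w assume "w \<in> Poly_Mapping.keys (x * y)"
    then obtain u v where "u \<in> Poly_Mapping.keys x" "v \<in> Poly_Mapping.keys y" "w = u + v"
      using keys_mult[of x y] by blast
    with that show "set (letters w) \<subseteq> G"
      unfolding mem_free_alg_ring by (auto simp: plus_word_monoid_def)
  qed
  show "- x \<in> carrier (free_alg_ring G)" if "x \<in> carrier (free_alg_ring G)"
    using that unfolding mem_free_alg_ring by simp
  show "scalar c \<in> carrier (free_alg_ring G)"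
    unfolding mem_free_alg_ring scalar_def by (simp add: zero_word_monoid_def)
  show "1 \<in> carrier (free_alg_ring G)"
    unfolding mem_free_alg_ring single_one[symmetric] by (simp add: zero_word_monoid_def)
  show "0 \<in> carrier (free_alg_ring G)"
    unfolding mem_free_alg_ring by simp
  show "gen g \<in> carrier (free_alg_ring G)" if "g \<in> G"
    using that unfolding mem_free_alg_ring gen_def by simp
qed

lemma ring_free_alg_ring: "ring (free_alg_ring G)"
proof (rule ringI)
  show "abelian_group (free_alg_ring G)"
  proof (rule abelian_groupI)
    show "\<exists>y\<in>carrier (free_alg_ring G). y \<oplus>\<^bsub>free_alg_ring G\<^esub> x = \<zero>\<^bsub>free_alg_ring G\<^esub>"
      if "x \<in> carrier (free_alg_ring G)" for x
      using free_alg_closed(4)[OF that] by (intro bexI[of _ "- x"]) simp_all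
  qed (simp_all add: free_alg_closed algebra_simps)
  show "Group.monoid (free_alg_ring G)"
    by (rule monoidI) (simp_all add: free_alg_closed mult.assoc)
qed (simp_all add: algebra_simps)

lemma a_minus_free_alg_ring:
  assumes "x \<in> carrier (free_alg_ring G)" "y \<in> carrier (free_alg_ring G)"
  shows "x \<ominus>\<^bsub>free_alg_ring G\<^esub> y = x - y"
proof -
  interpret ring "free_alg_ring G" by (rule ring_free_alg_ring)
  have "(\<ominus>\<^bsub>free_alg_ring G\<^esub> y) = - y"
    using assms free_alg_closed(4)[OF assms(2)] by (intro minus_equality) auto
  then show ?thesis by (simp add: a_minus_def)
qed

lemma scalar_central: "scalar c * x = x * scalar c"
proof (induction x rule: update_induct)
  case const
  show ?case by simp
next
  case (update f k v)
  have "Poly_Mapping.update k v f = Poly_Mapping.single k v + f"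
    using update by (intro poly_mapping_eqI)
      (auto simp: lookup_update lookup_add lookup_single in_keys_iff when_def)
  moreover have "scalar c * Poly_Mapping.single k v = Poly_Mapping.single k v * scalar c"
    by (simp add: scalar_def mult_single mult.commute)
  ultimately show ?case using update by (simp add: algebra_simps)
qed

lemma homogeneous_mult:
  assumes "homogeneous m p x" "homogeneous m r y"
  shows "homogeneous m (p + r) (x * y)"
  unfolding homogeneous_def
proof
  fix w assume "w \<in> Poly_Mapping.keys (x * y)"
  then obtain u v where "u \<in> Poly_Mapping.keys x" "v \<in> Poly_Mapping.keys y" "w = u + v"
    using keys_mult[of x y] by blast
  with assms show "(\<Sum>g\<leftarrow>letters w. gen_grade m g) mod 2 = (p + r) mod 2"
    unfolding homogeneous_def by (auto simp: plus_word_monoid_def intro!: mod_add_cong)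
qed

lemma homogeneous_diff:
  "homogeneous m p x \<Longrightarrow> homogeneous m p y \<Longrightarrow> homogeneous m p (x - y)"
  using keys_diff[of x y] unfolding homogeneous_def by blast

lemma homogeneous_scalar: "homogeneous m 0 (scalar c)"
  by (simp add: homogeneous_def scalar_def zero_word_monoid_def)

lemma homogeneous_freeE: "homogeneous m (idx_grade m b + idx_grade m a) (freeE m qp b a)"
proof (induction m qp b a rule: freeE.induct)
  case (1 m qp b a)
  have comm: "homogeneous m r (x * y - scalar c * (y * x))"
    if "homogeneous m s x" "homogeneous m t y" "(s + t) mod 2 = r mod 2" for r s t c x y
  proof -
    have "homogeneous m (s + t) (x * y - scalar c * (y * x))"
      using homogeneous_mult[OF that(1,2)] homogeneous_mult[OF that(2,1)]
        homogeneous_mult[OF homogeneous_scalar[of m c] homogeneous_mult[OF that(2,1)]]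
      by (intro homogeneous_diff) (simp_all add: add.commute)
    with that(3) show ?thesis by (simp add: homogeneous_def)
  qed
  consider "b = a + 1" | "a = b + 1" | "a + 1 < b" | "b + 1 < a" | "a = b" by linarith
  then show ?case
  proof cases
    case 1
    then show ?thesis by (subst freeE.simps) (simp add: homogeneous_def gen_def)
  next
    case 2
    then show ?thesis by (subst freeE.simps) (simp add: homogeneous_def gen_def)
  next
    case 3
    with "1.IH"(1,2) have
      "homogeneous m (idx_grade m b + idx_grade m (a+1)) (freeE m qp b (a+1))"
      "homogeneous m (idx_grade m (a+1) + idx_grade m a) (freeE m qp (a+1) a)" by auto
    moreover have "(idx_grade m b + idx_grade m (a+1) + (idx_grade m (a+1) + idx_grade m a)) mod 2
      = (idx_grade m b + idx_grade m a) mod 2" by presburger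
    ultimately show ?thesis
      using 3 comm by (subst freeE.simps) auto
  next
    case 4
    with "1.IH"(5,6) have
      "homogeneous m (idx_grade m b + idx_grade m (b+1)) (freeE m qp b (b+1))"
      "homogeneous m (idx_grade m (b+1) + idx_grade m a) (freeE m qp (b+1) a)" by auto
    moreover have "(idx_grade m b + idx_grade m (b+1) + (idx_grade m (b+1) + idx_grade m a)) mod 2
      = (idx_grade m b + idx_grade m a) mod 2" by presburger
    ultimately show ?thesis
      using 4 comm by (subst freeE.simps) auto
  next
    case 5
    then show ?thesis by (subst freeE.simps) (simp add: homogeneous_def)
  qed
qed

context
  fixes m n :: nat and P :: "complex set" and qp :: "complex \<Rightarrow> complex"
  assumes one_P: "1 \<in> P" and diff_P: "\<And>M N. M \<in> P \<Longrightarrow> N \<in> P \<Longrightarrow> M - N \<in> P"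
    and m_pos: "1 \<le> m" and n_pos: "1 \<le> n"
begin

lemma zero_P: "0 \<in> P"
  using diff_P[OF one_P one_P] by simp

lemma uminus_P: "N \<in> P \<Longrightarrow> - N \<in> P"
  using diff_P[OF zero_P] by simp

lemma add_P: "M \<in> P \<Longrightarrow> N \<in> P \<Longrightarrow> M + N \<in> P"
  using diff_P[OF _ uminus_P] by fastforce

lemma ring_Uq_free: "ring (Uq_free m n P)"
  unfolding Uq_free_def by (rule ring_free_alg_ring)

lemmas Uq_free_closed = free_alg_closed[where G = "generators m n P", folded Uq_free_def]

lemma freeK_closed: "a \<in> {1..m+n} \<Longrightarrow> N \<in> P \<Longrightarrow> freeK a N \<in> carrier (Uq_free m n P)"
  by (rule Uq_free_closed) (auto simp: generators_def)

lemma freeE_closed: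
  "b \<in> {1..m+n} \<Longrightarrow> a \<in> {1..m+n} \<Longrightarrow> freeE m qp b a \<in> carrier (Uq_free m n P)"
proof (induction "(b - a) + (a - b)" arbitrary: a b rule: less_induct)
  case less
  have L: "gen (Lower i) \<in> carrier (Uq_free m n P)" if "i \<in> {1..<m+n}" for i
    using that by (intro Uq_free_closed) (auto simp: generators_def)
  have R: "gen (Raise i) \<in> carrier (Uq_free m n P)" if "i \<in> {1..<m+n}" for i
    using that by (intro Uq_free_closed) (auto simp: generators_def)
  consider "b = a + 1" | "a = b + 1" | "a + 1 < b" | "b + 1 < a" | "a = b" by linarith
  then show ?case
  proof cases
    case 1
    with less.prems L[of a] show ?thesis by (subst freeE.simps) auto
  next
    case 2
    with less.prems R[of b] show ?thesis by (subst freeE.simps) auto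
  next
    case 3
    with less.prems have "freeE m qp b (a+1) \<in> carrier (Uq_free m n P)"
      "freeE m qp (a+1) a \<in> carrier (Uq_free m n P)"
      by (intro less.hyps; auto)+
    then have "freeE m qp b (a+1) * freeE m qp (a+1) a
       - scalar (qpow m qp (a+1) 1) * (freeE m qp (a+1) a * freeE m qp b (a+1))
       \<in> carrier (Uq_free m n P)"
      by (intro Uq_free_closed)
    with 3 show ?thesis by (subst freeE.simps) simp
  next
    case 4
    with less.prems have "freeE m qp b (b+1) \<in> carrier (Uq_free m n P)"
      "freeE m qp (b+1) a \<in> carrier (Uq_free m n P)"
      by (intro less.hyps; auto)+
    then have "freeE m qp b (b+1) * freeE m qp (b+1) a
       - scalar (qpow m qp (b+1) (- 1)) * (freeE m qp (b+1) a * freeE m qp b (b+1))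
       \<in> carrier (Uq_free m n P)"
      by (intro Uq_free_closed)
    with 4 show ?thesis by (subst freeE.simps) simp
  next
    case 5
    then show ?thesis by (subst freeE.simps) (simp add: Uq_free_closed)
  qed
qed

lemma graded_comm_closed:
  assumes "x \<in> carrier (Uq_free m n P)" "y \<in> carrier (Uq_free m n P)"
  shows "graded_comm m x y \<in> carrier (Uq_free m n P)"
proof -
  have "(- 1) ^ k \<in> carrier (Uq_free m n P)" for k
    by (induction k) (auto intro: Uq_free_closed)
  with assms show ?thesis unfolding graded_comm_def by (intro Uq_free_closed)
qed

lemma serre_closed:
  assumes "x \<in> carrier (Uq_free m n P)" "y \<in> carrier (Uq_free m n P)"
  shows "serre c x y \<in> carrier (Uq_free m n P)"
  using assms unfolding serre_def by (intro Uq_free_closed)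

lemma Uq_relations_closed: "Uq_relations m n P qp \<subseteq> carrier (Uq_free m n P)"
proof -
  have "cartan_relations m n P qp \<subseteq> carrier (Uq_free m n P)"
    unfolding cartan_relations_def
    by (intro Un_least subsetI; clarify; intro Uq_free_closed freeK_closed zero_P add_P; simp)
  moreover have "weight_relations m n P qp \<subseteq> carrier (Uq_free m n P)"
    unfolding weight_relations_def
    by (intro subsetI; clarify; intro Uq_free_closed freeK_closed freeE_closed; simp)
  moreover have "raise_lower_relations m n P qp \<subseteq> carrier (Uq_free m n P)"
    unfolding raise_lower_relations_def
    by (intro subsetI; clarify; intro Uq_free_closed graded_comm_closed freeK_closed freeE_closed
        one_P uminus_P; simp)
  moreover have "distant_relations m n P qp \<subseteq> carrier (Uq_free m n P)"
    unfolding distant_relations_def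
    by (intro Un_least subsetI; clarify; intro Uq_free_closed freeE_closed; simp)
  moreover have "nilpotency_relations m n P qp \<subseteq> carrier (Uq_free m n P)"
    unfolding nilpotency_relations_def power2_eq_square
    using m_pos n_pos by (auto intro!: Uq_free_closed(3) freeE_closed)
  moreover have "serre_relations m n P qp \<subseteq> carrier (Uq_free m n P)"
    unfolding serre_relations_def
    by (intro Un_least subsetI; clarify?; (elim CollectE conjE disjE)?; (hypsubst)?;
        intro serre_closed graded_comm_closed freeE_closed; (simp; arith))
  ultimately show ?thesis unfolding Uq_relations_def by blast
qed

lemma ideal_Uq_ideal: "ideal (Uq_ideal m n P qp) (Uq_free m n P)"
  unfolding Uq_ideal_def
  by (rule ring.genideal_ideal[OF ring_Uq_free Uq_relations_closed])

lemma ring_Uq: "ring (Uq m n P qp)"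
  unfolding Uq_def by (rule ideal.quotient_is_ring[OF ideal_Uq_ideal])

lemma Uq_class_hom: "Uq_class m n P qp \<in> ring_hom (Uq_free m n P) (Uq m n P qp)"
  using ideal.rcos_ring_hom[OF ideal_Uq_ideal]
  unfolding Uq_def Uq_class_def[abs_def] by simp

lemma Uq_ideal_closed:
  shows "x \<in> Uq_ideal m n P qp \<Longrightarrow> y \<in> Uq_ideal m n P qp \<Longrightarrow> x + y \<in> Uq_ideal m n P qp"
    and "x \<in> Uq_ideal m n P qp \<Longrightarrow> - x \<in> Uq_ideal m n P qp"
    and "x \<in> Uq_ideal m n P qp \<Longrightarrow> z \<in> carrier (Uq_free m n P) \<Longrightarrow> z * x \<in> Uq_ideal m n P qp"
    and "x \<in> Uq_ideal m n P qp \<Longrightarrow> z \<in> carrier (Uq_free m n P) \<Longrightarrow> x * z \<in> Uq_ideal m n P qp"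
    and "0 \<in> Uq_ideal m n P qp"
proof -
  interpret ideal "Uq_ideal m n P qp" "Uq_free m n P" by (rule ideal_Uq_ideal)
  show "x \<in> Uq_ideal m n P qp \<Longrightarrow> y \<in> Uq_ideal m n P qp \<Longrightarrow> x + y \<in> Uq_ideal m n P qp"
    using additive_subgroup.a_closed[OF is_additive_subgroup, of x y] by (simp add: Uq_free_def)
  show mult: "z * x \<in> Uq_ideal m n P qp"
    if "x \<in> Uq_ideal m n P qp" "z \<in> carrier (Uq_free m n P)" for x z
    using I_l_closed[OF that] by (simp add: Uq_free_def)
  show "- x \<in> Uq_ideal m n P qp" if "x \<in> Uq_ideal m n P qp"
    using mult[OF that, of "- 1"] by (simp add: Uq_free_closed)
  show "x * z \<in> Uq_ideal m n P qp"
    if "x \<in> Uq_ideal m n P qp" "z \<in> carrier (Uq_free m n P)"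
    using I_r_closed[OF that] by (simp add: Uq_free_def)
  show "0 \<in> Uq_ideal m n P qp"
    using additive_subgroup.zero_closed[OF is_additive_subgroup] by (simp add: Uq_free_def)
qed

lemma Uq_ideal_diff:
  "x \<in> Uq_ideal m n P qp \<Longrightarrow> y \<in> Uq_ideal m n P qp \<Longrightarrow> x - y \<in> Uq_ideal m n P qp"
  using Uq_ideal_closed(1)[of x "- y"] Uq_ideal_closed(2)[of y] by simp

lemma Uq_relation_in_ideal: "x \<in> Uq_relations m n P qp \<Longrightarrow> x \<in> Uq_ideal m n P qp"
  using ring.genideal_self[OF ring_Uq_free Uq_relations_closed] unfolding Uq_ideal_def by blast

lemma Uq_class_eq_iff:
  assumes "x \<in> carrier (Uq_free m n P)" "y \<in> carrier (Uq_free m n P)"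
  shows "Uq_class m n P qp x = Uq_class m n P qp y \<longleftrightarrow> x - y \<in> Uq_ideal m n P qp"
  using ring.quotient_eq_iff_same_a_r_cos[OF ring_Uq_free ideal_Uq_ideal assms]
    a_minus_free_alg_ring[of x "generators m n P" y] assms
  unfolding Uq_class_def Uq_free_def by simp

lemma q_comm_commute:
  assumes "x * z - z * x \<in> Uq_ideal m n P qp" "y * z - z * y \<in> Uq_ideal m n P qp"
    and "x \<in> carrier (Uq_free m n P)" "y \<in> carrier (Uq_free m n P)"
  shows "(x * y - scalar c * (y * x)) * z - z * (x * y - scalar c * (y * x))
    \<in> Uq_ideal m n P qp"
proof -
  have "(x * y - scalar c * (y * x)) * z - z * (x * y - scalar c * (y * x))
    = (x * (y * z - z * y) + (x * z - z * x) * y)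
      - scalar c * (y * (x * z - z * x) + (y * z - z * y) * x)"
    using scalar_central[of c z] by (simp add: algebra_simps flip: mult.assoc)
  also have "\<dots> \<in> Uq_ideal m n P qp"
    by (intro Uq_ideal_diff Uq_ideal_closed Uq_free_closed assms)
  finally show ?thesis .
qed

lemma freeE_lower_commute:
  assumes "1 \<le> a" "a + 1 < c" "c < b" "b \<le> m + n"
  shows "freeE m qp b c * freeE m qp (a+1) a - freeE m qp (a+1) a * freeE m qp b c
    \<in> Uq_ideal m n P qp"
  using assms
proof (induction "b - c" arbitrary: c rule: less_induct)
  case less
  have simple: "freeE m qp (c+1) c * freeE m qp (a+1) a - freeE m qp (a+1) a * freeE m qp (c+1) c
    \<in> Uq_ideal m n P qp"
  proof (rule Uq_relation_in_ideal)
    have "a \<in> {1..<m+n}" "c \<in> {1..<m+n}" "c + 1 < a \<or> a + 1 < c" using less.prems by auto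
    then show "freeE m qp (c+1) c * freeE m qp (a+1) a - freeE m qp (a+1) a * freeE m qp (c+1) c
      \<in> Uq_relations m n P qp"
      unfolding Uq_relations_def distant_relations_def by blast
  qed
  show ?case
  proof (cases "b = c + 1")
    case True
    with simple show ?thesis by simp
  next
    case False
    have "freeE m qp b (c+1) * freeE m qp (a+1) a - freeE m qp (a+1) a * freeE m qp b (c+1)
      \<in> Uq_ideal m n P qp"
      using less.prems False by (intro less.hyps) auto
    moreover have "freeE m qp b c = freeE m qp b (c+1) * freeE m qp (c+1) c
       - scalar (qpow m qp (c+1) 1) * (freeE m qp (c+1) c * freeE m qp b (c+1))"
      using False less.prems by (subst freeE.simps) simp
    ultimately show ?thesis
      using q_comm_commute[OF _ simple] freeE_closed less.prems by simp
  qed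
qed

lemma freeE_raise_commute:
  assumes "1 \<le> a" "a + 1 < c" "c < b" "b \<le> m + n"
  shows "freeE m qp c b * freeE m qp a (a+1) - freeE m qp a (a+1) * freeE m qp c b
    \<in> Uq_ideal m n P qp"
  using assms
proof (induction "b - c" arbitrary: c rule: less_induct)
  case less
  have simple: "freeE m qp c (c+1) * freeE m qp a (a+1) - freeE m qp a (a+1) * freeE m qp c (c+1)
    \<in> Uq_ideal m n P qp"
  proof (rule Uq_relation_in_ideal)
    have "a \<in> {1..<m+n}" "c \<in> {1..<m+n}" "c + 1 < a \<or> a + 1 < c" using less.prems by auto
    then show "freeE m qp c (c+1) * freeE m qp a (a+1) - freeE m qp a (a+1) * freeE m qp c (c+1)
      \<in> Uq_relations m n P qp"
      unfolding Uq_relations_def distant_relations_def by blast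
  qed
  show ?case
  proof (cases "b = c + 1")
    case True
    with simple show ?thesis by simp
  next
    case False
    have "freeE m qp (c+1) b * freeE m qp a (a+1) - freeE m qp a (a+1) * freeE m qp (c+1) b
      \<in> Uq_ideal m n P qp"
      using less.prems False by (intro less.hyps) auto
    moreover have "freeE m qp c b = freeE m qp c (c+1) * freeE m qp (c+1) b
       - scalar (qpow m qp (c+1) (- 1)) * (freeE m qp (c+1) b * freeE m qp c (c+1))"
      using False less.prems by (subst freeE.simps) simp
    ultimately show ?thesis
      using q_comm_commute[OF simple] freeE_closed less.prems by simp
  qed
qed

lemma freeE_lowering:
  assumes "1 \<le> a" "a < c" "c < b" "b \<le> m + n"
  shows "freeE m qp b a - (freeE m qp b c * freeE m qp c a
      - scalar (qpow m qp c 1) * (freeE m qp c a * freeE m qp b c)) \<in> Uq_ideal m n P qp"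
  using assms
proof (induction "b - a" arbitrary: a rule: less_induct)
  case less
  define Z where "Z = freeE m qp (a+1) a"
  define V where "V = freeE m qp b (a+1)"
  define r :: "generator free_algebra" where "r = scalar (qpow m qp (a+1) 1)"
  have ba: "freeE m qp b a = V * Z - r * (Z * V)"
    unfolding V_def Z_def r_def using less.prems by (subst freeE.simps) simp
  show ?case
  proof (cases "c = a + 1")
    case True
    then show ?thesis using ba by (simp add: V_def Z_def r_def Uq_ideal_closed)
  next
    case False
    define X where "X = freeE m qp b c"
    define Y where "Y = freeE m qp c (a+1)"
    define q :: "generator free_algebra" where "q = scalar (qpow m qp c 1)"
    have ca: "freeE m qp c a = Y * Z - r * (Z * Y)"
      unfolding Y_def Z_def r_def using less.prems False by (subst freeE.simps) simp
    have IH: "V - (X * Y - q * (Y * X)) \<in> Uq_ideal m n P qp"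
      unfolding V_def X_def Y_def q_def using less.prems False by (intro less.hyps) auto
    have comm: "X * Z - Z * X \<in> Uq_ideal m n P qp"
      unfolding X_def Z_def using less.prems False by (intro freeE_lower_commute) auto
    have closed: "X \<in> carrier (Uq_free m n P)" "Y \<in> carrier (Uq_free m n P)"
      "Z \<in> carrier (Uq_free m n P)" "r \<in> carrier (Uq_free m n P)" "q \<in> carrier (Uq_free m n P)"
      unfolding X_def Y_def Z_def r_def q_def using less.prems
      by (auto intro!: freeE_closed Uq_free_closed)
    have q: "x * (q * y) = q * (x * y)" and r: "x * (r * y) = r * (x * y)" for x y
      unfolding q_def r_def by (metis scalar_central mult.assoc)+
    note central = q[of X] q[of Y] q[of Z] q[of V] q[of r] r[of X] r[of Y] r[of Z] r[of V]
    have "freeE m qp b a - (X * freeE m qp c a - q * (freeE m qp c a * X))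
      = (V - (X * Y - q * (Y * X))) * Z - r * (Z * (V - (X * Y - q * (Y * X))))
        + (r * ((X * Z - Z * X) * Y) - q * (Y * (X * Z - Z * X)))"
      unfolding ba ca by (simp add: algebra_simps central)
    also have "\<dots> \<in> Uq_ideal m n P qp"
      by (intro Uq_ideal_closed Uq_ideal_diff IH comm closed)
    finally show ?thesis by (simp add: X_def q_def)
  qed
qed

lemma freeE_raising:
  assumes "1 \<le> a" "a < c" "c < b" "b \<le> m + n"
  shows "freeE m qp a b - (freeE m qp a c * freeE m qp c b
      - scalar (qpow m qp c (- 1)) * (freeE m qp c b * freeE m qp a c)) \<in> Uq_ideal m n P qp"
  using assms
proof (induction "b - a" arbitrary: a rule: less_induct)
  case less
  define Z where "Z = freeE m qp a (a+1)"
  define V where "V = freeE m qp (a+1) b"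
  define r :: "generator free_algebra" where "r = scalar (qpow m qp (a+1) (- 1))"
  have ab: "freeE m qp a b = Z * V - r * (V * Z)"
    unfolding V_def Z_def r_def using less.prems by (subst freeE.simps) simp
  show ?case
  proof (cases "c = a + 1")
    case True
    then show ?thesis using ab by (simp add: V_def Z_def r_def Uq_ideal_closed)
  next
    case False
    define X where "X = freeE m qp c b"
    define Y where "Y = freeE m qp (a+1) c"
    define q :: "generator free_algebra" where "q = scalar (qpow m qp c (- 1))"
    have ac: "freeE m qp a c = Z * Y - r * (Y * Z)"
      unfolding Y_def Z_def r_def using less.prems False by (subst freeE.simps) simp
    have IH: "V - (Y * X - q * (X * Y)) \<in> Uq_ideal m n P qp"
      unfolding V_def X_def Y_def q_def using less.prems False by (intro less.hyps) auto
    have comm: "X * Z - Z * X \<in> Uq_ideal m n P qp"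
      unfolding X_def Z_def using less.prems False by (intro freeE_raise_commute) auto
    have closed: "X \<in> carrier (Uq_free m n P)" "Y \<in> carrier (Uq_free m n P)"
      "Z \<in> carrier (Uq_free m n P)" "r \<in> carrier (Uq_free m n P)" "q \<in> carrier (Uq_free m n P)"
      unfolding X_def Y_def Z_def r_def q_def using less.prems
      by (auto intro!: freeE_closed Uq_free_closed)
    have q: "x * (q * y) = q * (x * y)" and r: "x * (r * y) = r * (x * y)" for x y
      unfolding q_def r_def by (metis scalar_central mult.assoc)+
    note central = q[of X] q[of Y] q[of Z] q[of V] q[of r] r[of X] r[of Y] r[of Z] r[of V]
    have "freeE m qp a b - (freeE m qp a c * X - q * (X * freeE m qp a c))
      = Z * (V - (Y * X - q * (X * Y))) - r * ((V - (Y * X - q * (X * Y))) * Z)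
        + (q * ((X * Z - Z * X) * Y) - r * (Y * (X * Z - Z * X)))"
      unfolding ab ac by (simp add: algebra_simps central)
    also have "\<dots> \<in> Uq_ideal m n P qp"
      by (intro Uq_ideal_closed Uq_ideal_diff IH comm closed)
    finally show ?thesis by (simp add: X_def q_def)
  qed
qed

lemma Uq_class_q_comm:
  assumes "x \<in> carrier (Uq_free m n P)" "y \<in> carrier (Uq_free m n P)"
  shows "Uq_class m n P qp (x * y - scalar c * (y * x))
    = Uq_class m n P qp x \<otimes>\<^bsub>Uq m n P qp\<^esub> Uq_class m n P qp y
      \<ominus>\<^bsub>Uq m n P qp\<^esub> Uq_scalar m n P qp c \<otimes>\<^bsub>Uq m n P qp\<^esub>
        (Uq_class m n P qp y \<otimes>\<^bsub>Uq m n P qp\<^esub> Uq_class m n P qp x)"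
proof -
  interpret H: ring_hom_ring "Uq_free m n P" "Uq m n P qp" "Uq_class m n P qp"
    by (intro ring_hom_ringI2 ring_Uq_free ring_Uq Uq_class_hom)
  have cl: "x * y \<in> carrier (Uq_free m n P)" "y * x \<in> carrier (Uq_free m n P)"
    "scalar c * (y * x) \<in> carrier (Uq_free m n P)" "scalar c \<in> carrier (Uq_free m n P)"
    using assms by (auto intro!: Uq_free_closed)
  have mult: "u * v = u \<otimes>\<^bsub>Uq_free m n P\<^esub> v" for u v
    by (simp add: Uq_free_def)
  have "x * y - scalar c * (y * x) = x * y \<ominus>\<^bsub>Uq_free m n P\<^esub> scalar c * (y * x)"
    using a_minus_free_alg_ring cl unfolding Uq_free_def by metis
  then show ?thesis
    using assms cl unfolding mult Uq_scalar_def by (simp add: a_minus_def)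
qed

text \<open>The recursive description of the nonsimple generators holds for every intermediate
  index.\<close>

theorem Uq_E_lowering:
  assumes "1 \<le> a" "a < c" "c < b" "b \<le> m + n"
  shows "Uq_E m n P qp b a
    = Uq_E m n P qp b c \<otimes>\<^bsub>Uq m n P qp\<^esub> Uq_E m n P qp c a
      \<ominus>\<^bsub>Uq m n P qp\<^esub> Uq_scalar m n P qp (qpow m qp c 1) \<otimes>\<^bsub>Uq m n P qp\<^esub>
        (Uq_E m n P qp c a \<otimes>\<^bsub>Uq m n P qp\<^esub> Uq_E m n P qp b c)"
proof -
  have cl: "freeE m qp b a \<in> carrier (Uq_free m n P)" "freeE m qp b c \<in> carrier (Uq_free m n P)"
    "freeE m qp c a \<in> carrier (Uq_free m n P)"
    using assms by (auto intro!: freeE_closed)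
  have "Uq_E m n P qp b a = Uq_class m n P qp (freeE m qp b c * freeE m qp c a
      - scalar (qpow m qp c 1) * (freeE m qp c a * freeE m qp b c))"
    unfolding Uq_E_def using freeE_lowering[OF assms] cl
    by (subst Uq_class_eq_iff) (auto intro!: Uq_free_closed)
  then show ?thesis
    unfolding Uq_class_q_comm[OF cl(2,3)] Uq_E_def .
qed

theorem Uq_E_raising:
  assumes "1 \<le> a" "a < c" "c < b" "b \<le> m + n"
  shows "Uq_E m n P qp a b
    = Uq_E m n P qp a c \<otimes>\<^bsub>Uq m n P qp\<^esub> Uq_E m n P qp c b
      \<ominus>\<^bsub>Uq m n P qp\<^esub> Uq_scalar m n P qp (qpow m qp c (- 1)) \<otimes>\<^bsub>Uq m n P qp\<^esub>
        (Uq_E m n P qp c b \<otimes>\<^bsub>Uq m n P qp\<^esub> Uq_E m n P qp a c)"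
proof -
  have cl: "freeE m qp a b \<in> carrier (Uq_free m n P)" "freeE m qp a c \<in> carrier (Uq_free m n P)"
    "freeE m qp c b \<in> carrier (Uq_free m n P)"
    using assms by (auto intro!: freeE_closed)
  have "Uq_E m n P qp a b = Uq_class m n P qp (freeE m qp a c * freeE m qp c b
      - scalar (qpow m qp c (- 1)) * (freeE m qp c b * freeE m qp a c))"
    unfolding Uq_E_def using freeE_raising[OF assms] cl
    by (subst Uq_class_eq_iff) (auto intro!: Uq_free_closed)
  then show ?thesis
    unfolding Uq_class_q_comm[OF cl(2,3)] Uq_E_def .
qed

end

end

theory Submission
  imports Defs
begin

text \<open>Say that \<open>x\<close> has weight \<open>s\<close> for \<open>K = K\<^sub>a\<^sup>N\<close> if \<open>K x = s x K\<close> in the quotient. Weights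
  multiply: if \<open>x\<close> and \<open>y\<close> have weights \<open>s\<close> and \<open>t\<close>, then both \<open>x y\<close> and \<open>y x\<close>
  have weight \<open>s t\<close>, and hence so has every combination \<open>x y - r y x\<close>
  (lemma \<open>weight_q_comm\<close>), whatever the number \<open>r\<close> is. A nonsimple root vector is such a combination of
  \<open>E\<^sup>b\<^sub>d\<close> and \<open>E\<^sup>d\<^sub>c\<close> for some \<open>d\<close> strictly between \<open>b\<close> and \<open>c\<close>
  (lemma \<open>freeE_split\<close>), and the exponents telescope,
  \<open>(\<delta>\<^sup>a\<^sub>b - \<delta>\<^sup>a\<^sub>d) + (\<delta>\<^sup>a\<^sub>d - \<delta>\<^sup>a\<^sub>c) = \<delta>\<^sup>a\<^sub>b - \<delta>\<^sup>a\<^sub>c\<close>. So the weight relations for the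
  simple generators, which are among the defining relations, propagate to all root
  vectors by induction on \<open>\<bar>b - c\<bar>\<close> (lemma \<open>freeE_weight\<close>).

  For \<open>b = c\<close> the exponent vanishes, and the claim is a defining relation because
  \<open>q\<^sup>0 = 1\<close>.\<close>

lemma scalar_mult: "scalar c * scalar d = scalar (c * d)"
  by (simp add: scalar_def mult_single)

lemma scalar_one: "scalar 1 = 1"
  by (simp add: scalar_def)

text \<open>Weights do not see the factor \<open>r\<close>, so hiding it behind an existential lets one
  induction treat raising and lowering root vectors together.\<close>

lemma freeE_split:
  assumes "b \<noteq> c" "c \<noteq> b + 1" "b \<noteq> c + 1"
  obtains d r where "min b c < d" "d < max b c"
    and "freeE m qp b c = freeE m qp b d * freeE m qp d c
      - scalar r * (freeE m qp d c * freeE m qp b d)"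
proof (cases "c < b")
  case True
  have "freeE m qp b c = freeE m qp b (c+1) * freeE m qp (c+1) c
      - scalar (qpow m qp (c+1) 1) * (freeE m qp (c+1) c * freeE m qp b (c+1))"
    using True assms by (subst freeE.simps) simp
  then show thesis using True assms by (intro that[of "c+1"]) auto
next
  case False
  have "freeE m qp b c = freeE m qp b (b+1) * freeE m qp (b+1) c
      - scalar (qpow m qp (b+1) (- 1)) * (freeE m qp (b+1) c * freeE m qp b (b+1))"
    using False assms by (subst freeE.simps) simp
  then show thesis using False assms by (intro that[of "b+1"]) auto
qed

context
  fixes m n :: nat and P :: "complex set" and qp :: "complex \<Rightarrow> complex"
  assumes one_P: "1 \<in> P" and diff_P: "\<And>M N. M \<in> P \<Longrightarrow> N \<in> P \<Longrightarrow> M - N \<in> P"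
    and m_pos: "1 \<le> m" and n_pos: "1 \<le> n"
begin

lemmas P_closed = zero_P[OF one_P diff_P m_pos n_pos]
  uminus_P[OF one_P diff_P m_pos n_pos] add_P[OF one_P diff_P m_pos n_pos]
lemmas free_closed = Uq_free_closed[OF one_P diff_P m_pos n_pos]
lemmas E_closed = freeE_closed[OF one_P diff_P m_pos n_pos]
lemmas K_closed = freeK_closed[OF one_P diff_P m_pos n_pos]
lemmas ideal_closed = Uq_ideal_closed[OF one_P diff_P m_pos n_pos]
  Uq_ideal_diff[OF one_P diff_P m_pos n_pos]
lemmas relation_in_ideal = Uq_relation_in_ideal[OF one_P diff_P m_pos n_pos]

lemma weight_mult:
  assumes "k * x - scalar s * (x * k) \<in> Uq_ideal m n P qp"
    and "k * y - scalar t * (y * k) \<in> Uq_ideal m n P qp"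
    and "x \<in> carrier (Uq_free m n P)" "y \<in> carrier (Uq_free m n P)"
  shows "k * (x * y) - scalar (s * t) * (x * y * k) \<in> Uq_ideal m n P qp"
proof -
  have "x * (scalar t * z) = scalar t * (x * z)" for z
    by (metis scalar_central mult.assoc)
  then have "k * (x * y) - scalar (s * t) * (x * y * k)
    = (k * x - scalar s * (x * k)) * y + scalar s * (x * (k * y - scalar t * (y * k)))"
    by (simp add: algebra_simps flip: scalar_mult)
  also have "\<dots> \<in> Uq_ideal m n P qp"
    by (intro ideal_closed free_closed assms)
  finally show ?thesis .
qed

text \<open>The weight \<open>s t\<close> of \<open>x y\<close> is also the weight \<open>t s\<close> of \<open>y x\<close>, and scalars are
  central, so the two terms of the \<open>r\<close>-commutator scale together.\<close>

lemma weight_q_comm: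
  assumes "k * x - scalar s * (x * k) \<in> Uq_ideal m n P qp"
    and "k * y - scalar t * (y * k) \<in> Uq_ideal m n P qp"
    and "x \<in> carrier (Uq_free m n P)" "y \<in> carrier (Uq_free m n P)"
  shows "k * (x * y - scalar r * (y * x))
    - scalar (s * t) * ((x * y - scalar r * (y * x)) * k) \<in> Uq_ideal m n P qp"
proof -
  have "z * (scalar r * w) = scalar r * (z * w)" for z w :: "generator free_algebra"
    by (metis scalar_central mult.assoc)
  then have "k * (x * y - scalar r * (y * x))
      - scalar (s * t) * ((x * y - scalar r * (y * x)) * k)
    = (k * (x * y) - scalar (s * t) * (x * y * k))
      - scalar r * (k * (y * x) - scalar (t * s) * (y * x * k))"
    by (simp add: algebra_simps)
  also have "\<dots> \<in> Uq_ideal m n P qp"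
    by (intro ideal_closed free_closed weight_mult assms)
  finally show ?thesis .
qed

lemma kdelta_exponent_in_P: "N \<in> P \<Longrightarrow> N * (kdelta a b - kdelta a c) \<in> P"
  using P_closed by (auto simp: kdelta_def)

lemma qpow_add:
  assumes "\<And>M N. M \<in> P \<Longrightarrow> N \<in> P \<Longrightarrow> qp (M + N) = qp M * qp N" "x \<in> P" "y \<in> P"
  shows "qpow m qp a (x + y) = qpow m qp a x * qpow m qp a y"
  using assms(1)[OF assms(2,3)] assms(1)[of "- x" "- y"] assms(2,3) P_closed(2)
  by (auto simp: qpow_def idx_grade_def)

text \<open>The split index telescopes away: its Kronecker deltas cancel in the product of the
  two weights.\<close>

lemma freeE_weight:
  assumes qp_add: "\<And>M N. M \<in> P \<Longrightarrow> N \<in> P \<Longrightarrow> qp (M + N) = qp M * qp N"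
    and a: "a \<in> {1..m+n}" and N: "N \<in> P"
    and "b \<in> {1..m+n}" "c \<in> {1..m+n}" "b \<noteq> c"
  shows "freeK a N * freeE m qp b c
    - scalar (qpow m qp a (N * (kdelta a b - kdelta a c))) * (freeE m qp b c * freeK a N)
    \<in> Uq_ideal m n P qp"
  using assms(4-6)
proof (induction "(b - c) + (c - b)" arbitrary: b c rule: less_induct)
  case less
  show ?case
  proof (cases "c = b + 1 \<or> b = c + 1")
    case True
    then have "freeK a N * freeE m qp b c
      - scalar (qpow m qp a (N * (kdelta a b - kdelta a c))) * (freeE m qp b c * freeK a N)
      \<in> weight_relations m n P qp"
      using a N less.prems unfolding weight_relations_def mem_Collect_eq
      by (intro exI[of _ a] exI[of _ b] exI[of _ c] exI[of _ N]) simp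
    then show ?thesis
      by (intro relation_in_ideal) (auto simp only: Uq_relations_def)
  next
    case False
    with less.prems obtain d r where d: "min b c < d" "d < max b c"
      and E: "freeE m qp b c = freeE m qp b d * freeE m qp d c
        - scalar r * (freeE m qp d c * freeE m qp b d)"
      by (metis freeE_split)
    define w where "w = (\<lambda>i j. N * (kdelta a i - kdelta a j))"
    have IH: "freeK a N * freeE m qp b d
        - scalar (qpow m qp a (w b d)) * (freeE m qp b d * freeK a N) \<in> Uq_ideal m n P qp"
      "freeK a N * freeE m qp d c
        - scalar (qpow m qp a (w d c)) * (freeE m qp d c * freeK a N) \<in> Uq_ideal m n P qp"
      unfolding w_def by (intro less.hyps; use d less.prems in auto)+
    have "w b c = w b d + w d c"
      by (simp add: w_def algebra_simps)
    then have "qpow m qp a (w b c) = qpow m qp a (w b d) * qpow m qp a (w d c)"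
      using qpow_add[OF qp_add] kdelta_exponent_in_P[OF N] by (simp add: w_def)
    moreover have "freeE m qp b d \<in> carrier (Uq_free m n P)"
      "freeE m qp d c \<in> carrier (Uq_free m n P)"
      using d less.prems by (intro E_closed; auto)+
    ultimately show ?thesis
      using weight_q_comm[OF IH] unfolding E w_def by simp
  qed
qed

lemma Uq_class_weight:
  assumes "k * x - scalar s * (x * k) \<in> Uq_ideal m n P qp"
    and "k \<in> carrier (Uq_free m n P)" "x \<in> carrier (Uq_free m n P)"
  shows "Uq_class m n P qp k \<otimes>\<^bsub>Uq m n P qp\<^esub> Uq_class m n P qp x
    = Uq_scalar m n P qp s
      \<otimes>\<^bsub>Uq m n P qp\<^esub> (Uq_class m n P qp x \<otimes>\<^bsub>Uq m n P qp\<^esub> Uq_class m n P qp k)"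
proof -
  have hom: "Uq_class m n P qp (u * v)
      = Uq_class m n P qp u \<otimes>\<^bsub>Uq m n P qp\<^esub> Uq_class m n P qp v"
    if "u \<in> carrier (Uq_free m n P)" "v \<in> carrier (Uq_free m n P)" for u v
    using ring_hom_mult[OF Uq_class_hom[OF one_P diff_P m_pos n_pos] that]
    by (simp add: Uq_free_def)
  have "Uq_class m n P qp (k * x) = Uq_class m n P qp (scalar s * (x * k))"
    using assms by (subst Uq_class_eq_iff[OF one_P diff_P m_pos n_pos])
      (auto intro!: free_closed)
  then show ?thesis
    using assms(2,3) by (simp add: hom free_closed Uq_scalar_def)
qed

end

theorem lemma2:
  fixes m n :: nat
    and q :: complex
    and P :: "complex set"
    and qp :: "complex \<Rightarrow> complex"
  assumes "m \<ge> 1" and "n \<ge> 1"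
    and "q \<noteq> 0" and "q ^ 2 \<noteq> 1"
    and "1 \<in> P" and "\<And>M N. M \<in> P \<Longrightarrow> N \<in> P \<Longrightarrow> M - N \<in> P"
    and "qp 1 = q" and "\<And>M N. M \<in> P \<Longrightarrow> N \<in> P \<Longrightarrow> qp (M + N) = qp M * qp N"
  shows "\<forall>a\<in>{1..m+n}. \<forall>b\<in>{1..m+n}. \<forall>c\<in>{1..m+n}. \<forall>N\<in>P.
    (b \<noteq> c \<longrightarrow>
      Uq_K m n P qp a N \<otimes>\<^bsub>Uq m n P qp\<^esub> Uq_E m n P qp b c
      = Uq_scalar m n P qp (qpow m qp a (N * (kdelta a b - kdelta a c)))
          \<otimes>\<^bsub>Uq m n P qp\<^esub> (Uq_E m n P qp b c \<otimes>\<^bsub>Uq m n P qp\<^esub> Uq_K m n P qp a N))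
    \<and> (b = c \<longrightarrow> (\<forall>M\<in>P.
      Uq_K m n P qp a N \<otimes>\<^bsub>Uq m n P qp\<^esub> Uq_K m n P qp b M
      = Uq_scalar m n P qp (qpow m qp a (N * (kdelta a b - kdelta a c)))
          \<otimes>\<^bsub>Uq m n P qp\<^esub> (Uq_K m n P qp b M \<otimes>\<^bsub>Uq m n P qp\<^esub> Uq_K m n P qp a N)))"
proof (intro ballI conjI impI)
  fix a b c N
  assume a: "a \<in> {1..m+n}" and b: "b \<in> {1..m+n}" and c: "c \<in> {1..m+n}" and N: "N \<in> P"
  let ?s = "qpow m qp a (N * (kdelta a b - kdelta a c))"
  note Uq_ctx = assms(5,6,1,2)
  note K = freeK_closed[OF Uq_ctx]
  {
    assume "b \<noteq> c"
    then show "Uq_K m n P qp a N \<otimes>\<^bsub>Uq m n P qp\<^esub> Uq_E m n P qp b c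
      = Uq_scalar m n P qp ?s
          \<otimes>\<^bsub>Uq m n P qp\<^esub> (Uq_E m n P qp b c \<otimes>\<^bsub>Uq m n P qp\<^esub> Uq_K m n P qp a N)"
      unfolding Uq_K_def Uq_E_def
      by (intro Uq_class_weight[OF Uq_ctx] freeE_weight[OF Uq_ctx] K freeE_closed[OF Uq_ctx]
          assms(8) a b c N)
  next
    fix M assume "b = c" and M: "M \<in> P"
    \<comment> \<open>Additivity of \<open>qp\<close> at \<open>1 + 0\<close> forces \<open>q\<^sup>0 = 1\<close>, as \<open>q \<noteq> 0\<close>.\<close>
    have "q * qp 0 = q"
      using assms(8)[OF assms(5) zero_P[OF Uq_ctx]] assms(7) by simp
    then have s: "scalar ?s = 1"
      using \<open>b = c\<close> assms(3) by (simp add: qpow_def scalar_one)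
    have "freeK a N * freeK b M - freeK b M * freeK a N \<in> Uq_relations m n P qp"
      using a b N M unfolding Uq_relations_def cartan_relations_def by blast
    then have "freeK a N * freeK b M - scalar ?s * (freeK b M * freeK a N)
        \<in> Uq_ideal m n P qp"
      unfolding s using Uq_relation_in_ideal[OF Uq_ctx] by simp
    then show "Uq_K m n P qp a N \<otimes>\<^bsub>Uq m n P qp\<^esub> Uq_K m n P qp b M
      = Uq_scalar m n P qp ?s
          \<otimes>\<^bsub>Uq m n P qp\<^esub> (Uq_K m n P qp b M \<otimes>\<^bsub>Uq m n P qp\<^esub> Uq_K m n P qp a N)"
      unfolding Uq_K_def by (intro Uq_class_weight[OF Uq_ctx] K a b N M)
  }
qed

end
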